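(* Let $g$ and $h$ be real-valued functions on $[0,\infty)$ where $g\in\mathcal{BV}$ and $h\in\mathcal{HK}_{loc}$. Define $f=gh$, and let $s_0\in\mathbb{R}$. (a) Suppose there are positive constants $M$, $\delta$ and $K$ such that, if $|s-s_0|<\delta$ and $M_1,M_2>M$, then $\left|\int_{M_1}^{M_2}e^{-isx}h(x)\,dx\right|<K$. If $g(x)\to0$ as $x\to\infty$ then $\widehat f$ is continuous at $s_0$. (b) Let $H_s(x)=\int_0^x e^{-ist}h(t)\,dt$. If $\widehat h$ is continuous at $s_0$ and there are $\delta,K>0$ such that for all $x>0$ and $|s-s_0|<\delta$ we have $|H_s(x)|\le K$, then $\widehat f$ is continuous at $s_0$.
   Context: All integrals are Henstock--Kurzweil integrals; complex-valued functions are integrated by real and imaginary parts. $\mathcal{BV}$ here denotes functions of bounded variation on $[0,\infty)$, and $\mathcal{HK}_{loc}$ functions Henstock--Kurzweil integrable on every compact subinterval of $[0,\infty)$. For a function $u$ on $[0,\infty)$, $\widehat u(s)=\int_0^\infty e^{-isx}u(x)\,dx$. Continuity of $\widehat u$ at $s_0$ is understood to include that $\widehat u$ exists in a neighbourhood of $s_0$. *)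

theory Defs
  imports "HOL-Analysis.Analysis"
begin

text \<open>
  The partition points are \<open>x 0 \<le> \<dots> \<le> x n\<close>, all of them in \<open>S\<close>; repeated points contribute
  nothing to the sum. For unbounded \<open>S\<close> the bound \<open>B\<close> is uniform over all finite partitions.
\<close>

definition bounded_variation_on :: "real set \<Rightarrow> (real \<Rightarrow> real) \<Rightarrow> bool" where
  "bounded_variation_on S g \<longleftrightarrow>
     (\<exists>B. \<forall>(n::nat) (x::nat \<Rightarrow> real).
        (\<forall>i\<le>n. x i \<in> S) \<and> (\<forall>i<n. x i \<le> x (Suc i)) \<longrightarrow>
        (\<Sum>i<n. \<bar>g (x (Suc i)) - g (x i)\<bar>) \<le> B)"

definition hk_locally_integrable :: "(real \<Rightarrow> real) \<Rightarrow> bool" where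
  "hk_locally_integrable h \<longleftrightarrow> (\<forall>a b. 0 \<le> a \<longrightarrow> a \<le> b \<longrightarrow> h integrable_on {a..b})"

definition fourier_integrand :: "(real \<Rightarrow> real) \<Rightarrow> real \<Rightarrow> real \<Rightarrow> complex" where
  "fourier_integrand u s x = exp (- (\<i> * of_real s * of_real x)) * of_real (u x)"

text \<open>
  The library's gauge integral over the unbounded set \<open>{0..}\<close> is the Henstock--Kurzweil integral
  over the half-line; in particular it includes conditionally convergent integrals.
  Where the integral does not exist, \<open>fourier_hk u s\<close> has the default value \<open>0\<close>, so existence
  is always required separately.
\<close>

definition fourier_hk_exists :: "(real \<Rightarrow> real) \<Rightarrow> real \<Rightarrow> bool" where
  "fourier_hk_exists u s \<longleftrightarrow> fourier_integrand u s integrable_on {0..}"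

definition fourier_hk :: "(real \<Rightarrow> real) \<Rightarrow> real \<Rightarrow> complex" where
  "fourier_hk u s = integral {0..} (fourier_integrand u s)"

definition fourier_hk_continuous_at :: "(real \<Rightarrow> real) \<Rightarrow> real \<Rightarrow> bool" where
  "fourier_hk_continuous_at u s0 \<longleftrightarrow>
     (\<forall>\<^sub>F s in nhds s0. fourier_hk_exists u s) \<and> isCont (fourier_hk u) s0"

end

theory Submission
  imports Defs
begin

text \<open>
  The question is whether the truncated integrals of \<open>exp (- \<i> s x) g x h x\<close> over \<open>{0..b}\<close>
  converge, as \<open>b\<close> tends to infinity, uniformly for \<open>s\<close> near \<open>s0\<close>. If they do, their limit is
  the Fourier transform of \<open>g * h\<close> and it is continuous, because each truncated integral is
  continuous in \<open>s\<close> (\<open>truncated_fourier_continuous\<close> and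
  \<open>fourier_hk_continuous_at_if_uniform_tails\<close>). As \<open>h\<close> may be only conditionally integrable,
  nothing can be estimated through \<open>\<bar>h\<bar>\<close>; the integrals are bounded by the second mean value
  theorem, which bounds an integral with a monotone weight by the end-point values of the weight
  and the integrals of the other factor over subintervals (\<open>integral_monotone_weight\<close>).

  If \<open>g\<close> is monotone and tends to \<open>0\<close>, the tail over \<open>{b..c}\<close> is at most a constant times
  \<open>\<bar>g b\<bar> + \<bar>g c\<bar>\<close>, uniformly in \<open>s\<close>. A function of bounded variation that tends to \<open>0\<close> is a
  difference of two such functions, by a Jordan decomposition whose components are shifted by
  their common limit. This is the first part.

  For the second part, \<open>g\<close> has a limit \<open>L\<close> at infinity, and
  \<open>g * h = (g - L) * h + L * h\<close>. The transform of \<open>L * h\<close> is continuous by assumption; the first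
  summand is covered by the first part, since an integral over \<open>{b..c}\<close> is a difference of two of
  the bounded integrals from \<open>0\<close>.
\<close>

section \<open>Monotone and Lipschitz weights in gauge integrals\<close>

text \<open>
  The second mean value theorem splits the weighted integral at some \<open>c\<close> into \<open>w a\<close> times
  one integral of \<open>f\<close> plus \<open>w b\<close> times another. The resulting bound involves \<open>f\<close> only through its
  integrals over subintervals, so it is available for conditionally integrable \<open>f\<close>.
\<close>

lemma integral_monotone_weight_real:
  fixes f w :: "real \<Rightarrow> real"
  assumes f: "f integrable_on {a..b}" and "a \<le> b" and w: "mono_on {a..b} w"
    and C: "\<And>c d. \<lbrakk>a \<le> c; c \<le> d; d \<le> b\<rbrakk> \<Longrightarrow> \<bar>integral {c..d} f\<bar> \<le> C"
  shows "(\<lambda>x. w x * f x) integrable_on {a..b}"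
    and "\<bar>integral {a..b} (\<lambda>x. w x * f x)\<bar> \<le> C * (\<bar>w a\<bar> + \<bar>w b\<bar>)"
proof -
  obtain c where c: "c \<in> {a..b}"
    and i: "((\<lambda>x. w x * f x) has_integral (w a * integral {a..c} f + w b * integral {c..b} f)) {a..b}"
    using second_mean_value_theorem_full[OF f \<open>a \<le> b\<close>, of w] mono_onD[OF w] by auto
  show "(\<lambda>x. w x * f x) integrable_on {a..b}"
    using i by blast
  have "\<bar>w a * integral {a..c} f + w b * integral {c..b} f\<bar>
      \<le> \<bar>w a\<bar> * \<bar>integral {a..c} f\<bar> + \<bar>w b\<bar> * \<bar>integral {c..b} f\<bar>"
    by (metis abs_mult abs_triangle_ineq)
  also have "\<dots> \<le> \<bar>w a\<bar> * C + \<bar>w b\<bar> * C"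
    using C c by (intro add_mono mult_left_mono) auto
  finally show "\<bar>integral {a..b} (\<lambda>x. w x * f x)\<bar> \<le> C * (\<bar>w a\<bar> + \<bar>w b\<bar>)"
    using integral_unique[OF i] by (simp add: algebra_simps)
qed

lemma integral_bounds_on_subintervals:
  fixes f :: "real \<Rightarrow> 'a::banach"
  assumes f: "f integrable_on {a..b}"
  shows "\<exists>C\<ge>0. \<forall>c d. a \<le> c \<and> c \<le> d \<and> d \<le> b \<longrightarrow> norm (integral {c..d} f) \<le> C"
proof -
  have "bounded ((\<lambda>x. integral {a..x} f) ` {a..b})"
    by (intro compact_imp_bounded compact_continuous_image indefinite_integral_continuous_1 f) simp
  then obtain B where B: "B > 0" "\<And>x. x \<in> {a..b} \<Longrightarrow> norm (integral {a..x} f) \<le> B"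
    unfolding bounded_pos by auto
  show ?thesis
  proof (intro exI[of _ "2 * B"] conjI allI impI; (elim conjE)?)
    show "2 * B \<ge> 0" using B by simp
  next
    fix c d assume cd: "a \<le> c" "c \<le> d" "d \<le> b"
    have "f integrable_on {a..d}"
      by (rule integrable_subinterval_real[OF f]) (use cd in auto)
    then have "integral {c..d} f = integral {a..d} f - integral {a..c} f"
      using Henstock_Kurzweil_Integration.integral_combine[of a c d f] cd
      by (simp add: algebra_simps)
    also have "norm \<dots> \<le> norm (integral {a..d} f) + norm (integral {a..c} f)"
      by (rule norm_triangle_ineq4)
    also have "\<dots> \<le> 2 * B"
      using B(2)[of d] B(2)[of c] cd by auto
    finally show "norm (integral {c..d} f) \<le> 2 * B" .
  qed
qed

lemma integrable_complexI:
  fixes f :: "real \<Rightarrow> complex"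
  assumes "(\<lambda>x. Re (f x)) integrable_on S" "(\<lambda>x. Im (f x)) integrable_on S"
  shows "f integrable_on S"
  using assms by (subst integrable_componentwise_iff) (auto simp: Basis_complex_def)

lemma Re_integral:
  fixes f :: "real \<Rightarrow> complex"
  assumes "f integrable_on S"
  shows "Re (integral S f) = integral S (\<lambda>x. Re (f x))"
  using has_integral_Re[OF integrable_integral[OF assms]] by (simp add: integral_unique)

lemma Im_integral:
  fixes f :: "real \<Rightarrow> complex"
  assumes "f integrable_on S"
  shows "Im (integral S f) = integral S (\<lambda>x. Im (f x))"
  using has_integral_Im[OF integrable_integral[OF assms]] by (simp add: integral_unique)

lemma integral_monotone_weight:
  fixes f :: "real \<Rightarrow> complex" and w :: "real \<Rightarrow> real"
  assumes f: "f integrable_on {a..b}" and "a \<le> b" and w: "mono_on {a..b} w"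
    and C: "\<And>c d. \<lbrakk>a \<le> c; c \<le> d; d \<le> b\<rbrakk> \<Longrightarrow> cmod (integral {c..d} f) \<le> C"
  shows "(\<lambda>x. of_real (w x) * f x) integrable_on {a..b}"
    and "cmod (integral {a..b} (\<lambda>x. of_real (w x) * f x)) \<le> 2 * C * (\<bar>w a\<bar> + \<bar>w b\<bar>)"
proof -
  have sub: "f integrable_on {c..d}" if "a \<le> c" "d \<le> b" for c d
    by (rule integrable_subinterval_real[OF f]) (use that in auto)
  have fRe: "(\<lambda>x. Re (f x)) integrable_on {a..b}" and fIm: "(\<lambda>x. Im (f x)) integrable_on {a..b}"
    using has_integral_Re has_integral_Im f by (blast intro: integrable_integral)+
  have CRe: "\<bar>integral {c..d} (\<lambda>x. Re (f x))\<bar> \<le> C" if "a \<le> c" "c \<le> d" "d \<le> b" for c d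
    using C[OF that] abs_Re_le_cmod[of "integral {c..d} f"] Re_integral[OF sub] that by fastforce
  have CIm: "\<bar>integral {c..d} (\<lambda>x. Im (f x))\<bar> \<le> C" if "a \<le> c" "c \<le> d" "d \<le> b" for c d
    using C[OF that] abs_Im_le_cmod[of "integral {c..d} f"] Im_integral[OF sub] that by fastforce
  note re = integral_monotone_weight_real[OF fRe \<open>a \<le> b\<close> w CRe]
  note im = integral_monotone_weight_real[OF fIm \<open>a \<le> b\<close> w CIm]
  show int: "(\<lambda>x. of_real (w x) * f x) integrable_on {a..b}"
    by (rule integrable_complexI) (use re(1) im(1) in simp_all)
  let ?I = "integral {a..b} (\<lambda>x. of_real (w x) * f x)"
  have "cmod ?I \<le> \<bar>Re ?I\<bar> + \<bar>Im ?I\<bar>"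
    by (rule cmod_le)
  also have "\<dots> \<le> C * (\<bar>w a\<bar> + \<bar>w b\<bar>) + C * (\<bar>w a\<bar> + \<bar>w b\<bar>)"
    using re(2) im(2) by (intro add_mono) (simp_all add: Re_integral[OF int] Im_integral[OF int])
  finally show "cmod ?I \<le> 2 * C * (\<bar>w a\<bar> + \<bar>w b\<bar>)"
    by (simp add: algebra_simps)
qed

text \<open>
  An \<open>L\<close>-Lipschitz function is the difference of the increasing functions \<open>r x + L * (x - a)\<close>
  and \<open>L * (x - a)\<close>, which reduces the claim to monotone weights. The bound is small as soon as \<open>r\<close> is
  small at the end points and has a small Lipschitz constant; this is what gives continuity in
  the parameter of a truncated Fourier integral, where \<open>\<bar>f\<bar>\<close> need not be integrable.
\<close>

lemma integral_Lipschitz_weight_real: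
  fixes f r :: "real \<Rightarrow> real"
  assumes f: "f integrable_on {a..b}" and "a \<le> b"
    and L: "\<And>x y. \<lbrakk>x \<in> {a..b}; y \<in> {a..b}\<rbrakk> \<Longrightarrow> \<bar>r x - r y\<bar> \<le> L * \<bar>x - y\<bar>" and "L \<ge> 0"
    and C: "\<And>c d. \<lbrakk>a \<le> c; c \<le> d; d \<le> b\<rbrakk> \<Longrightarrow> \<bar>integral {c..d} f\<bar> \<le> C"
  shows "(\<lambda>x. r x * f x) integrable_on {a..b}"
    and "\<bar>integral {a..b} (\<lambda>x. r x * f x)\<bar> \<le> C * (\<bar>r a\<bar> + \<bar>r b\<bar> + 2 * L * (b - a))"
proof -
  let ?u = "\<lambda>x. r x + L * (x - a)" and ?v = "\<lambda>x. L * (x - a)"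
  have u: "mono_on {a..b} ?u"
  proof (rule mono_onI)
    fix x y assume "x \<in> {a..b}" "y \<in> {a..b}" "x \<le> y"
    then have "r x - r y \<le> L * (y - x)"
      using L[of x y] by auto
    then show "?u x \<le> ?u y"
      by (simp add: algebra_simps)
  qed
  have v: "mono_on {a..b} ?v"
    using \<open>L \<ge> 0\<close> by (intro mono_onI) (simp add: mult_left_mono)
  note iu = integral_monotone_weight_real[OF f \<open>a \<le> b\<close> u C]
  note iv = integral_monotone_weight_real[OF f \<open>a \<le> b\<close> v C]
  have eq: "(\<lambda>x. r x * f x) = (\<lambda>x. ?u x * f x - ?v x * f x)"
    by (auto simp: algebra_simps)
  show "(\<lambda>x. r x * f x) integrable_on {a..b}"
    unfolding eq by (intro integrable_diff iu(1) iv(1))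
  have "C \<ge> 0"
    using C[of a a] \<open>a \<le> b\<close> by simp
  have Lba: "0 \<le> L * (b - a)"
    using \<open>L \<ge> 0\<close> \<open>a \<le> b\<close> by simp
  have "\<bar>integral {a..b} (\<lambda>x. r x * f x)\<bar>
      = \<bar>integral {a..b} (\<lambda>x. ?u x * f x) - integral {a..b} (\<lambda>x. ?v x * f x)\<bar>"
    unfolding eq by (subst integral_diff[OF iu(1) iv(1)]) auto
  also have "\<dots> \<le> C * (\<bar>?u a\<bar> + \<bar>?u b\<bar>) + C * (\<bar>?v a\<bar> + \<bar>?v b\<bar>)"
    using iu(2) iv(2) by linarith
  also have "\<dots> = C * (\<bar>r a\<bar> + \<bar>r b + L * (b - a)\<bar> + L * (b - a))"
    using Lba by (simp add: algebra_simps)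
  also have "\<dots> \<le> C * (\<bar>r a\<bar> + \<bar>r b\<bar> + 2 * L * (b - a))"
    using Lba \<open>C \<ge> 0\<close> by (intro mult_left_mono) linarith+
  finally show "\<bar>integral {a..b} (\<lambda>x. r x * f x)\<bar> \<le> C * (\<bar>r a\<bar> + \<bar>r b\<bar> + 2 * L * (b - a))" .
qed

lemma integral_Lipschitz_weight:
  fixes f :: "real \<Rightarrow> real" and r :: "real \<Rightarrow> complex"
  assumes f: "f integrable_on {a..b}" and "a \<le> b"
    and L: "\<And>x y. \<lbrakk>x \<in> {a..b}; y \<in> {a..b}\<rbrakk> \<Longrightarrow> cmod (r x - r y) \<le> L * \<bar>x - y\<bar>" and "L \<ge> 0"
    and C: "\<And>c d. \<lbrakk>a \<le> c; c \<le> d; d \<le> b\<rbrakk> \<Longrightarrow> \<bar>integral {c..d} f\<bar> \<le> C"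
  shows "(\<lambda>x. r x * of_real (f x)) integrable_on {a..b}"
    and "cmod (integral {a..b} (\<lambda>x. r x * of_real (f x)))
           \<le> 2 * C * (cmod (r a) + cmod (r b) + 2 * L * (b - a))"
proof -
  have LRe: "\<bar>Re (r x) - Re (r y)\<bar> \<le> L * \<bar>x - y\<bar>" and LIm: "\<bar>Im (r x) - Im (r y)\<bar> \<le> L * \<bar>x - y\<bar>"
    if "x \<in> {a..b}" "y \<in> {a..b}" for x y
    using L[OF that] abs_Re_le_cmod[of "r x - r y"] abs_Im_le_cmod[of "r x - r y"] by auto
  note re = integral_Lipschitz_weight_real[OF f \<open>a \<le> b\<close> LRe \<open>L \<ge> 0\<close> C]
  note im = integral_Lipschitz_weight_real[OF f \<open>a \<le> b\<close> LIm \<open>L \<ge> 0\<close> C]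
  have "C \<ge> 0"
    using C[of a a] \<open>a \<le> b\<close> by simp
  show int: "(\<lambda>x. r x * of_real (f x)) integrable_on {a..b}"
    by (rule integrable_complexI) (use re(1) im(1) in simp_all)
  let ?I = "integral {a..b} (\<lambda>x. r x * of_real (f x))"
  let ?B = "cmod (r a) + cmod (r b) + 2 * L * (b - a)"
  have "cmod ?I \<le> \<bar>Re ?I\<bar> + \<bar>Im ?I\<bar>"
    by (rule cmod_le)
  also have "\<dots> \<le> C * (\<bar>Re (r a)\<bar> + \<bar>Re (r b)\<bar> + 2 * L * (b - a))
                 + C * (\<bar>Im (r a)\<bar> + \<bar>Im (r b)\<bar> + 2 * L * (b - a))"
    using re(2) im(2) by (intro add_mono) (simp_all add: Re_integral[OF int] Im_integral[OF int])
  also have "\<dots> \<le> C * ?B + C * ?B"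
    using \<open>C \<ge> 0\<close> abs_Re_le_cmod abs_Im_le_cmod
    by (intro add_mono mult_left_mono order_refl) auto
  finally show "cmod ?I \<le> 2 * C * ?B"
    by (simp add: algebra_simps)
qed

section \<open>Truncated Fourier transforms\<close>

text \<open>
  The kernel depends on \<open>s\<close> and \<open>x\<close> only through their product, so this one estimate gives the
  Lipschitz bound in either variable.
\<close>

lemma fourier_kernel_dist:
  fixes s t x :: real
  shows "cmod (exp (- (\<i> * of_real s * of_real x)) - exp (- (\<i> * of_real t * of_real x))) \<le> \<bar>s - t\<bar> * \<bar>x\<bar>"
proof -
  have "cmod (exp (- (\<i> * of_real x) * of_real s) - exp (- (\<i> * of_real x) * of_real t))
      \<le> \<bar>x\<bar> * cmod (of_real s - of_real t)"
  proof (rule field_differentiable_bound[where S = \<real>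
        and f' = "\<lambda>z. exp (- (\<i> * of_real x) * z) * (- (\<i> * of_real x))"])
    show "convex (\<real> :: complex set)"
      by (simp add: convex_Reals)
    show "((\<lambda>z. exp (- (\<i> * of_real x) * z)) has_field_derivative
        exp (- (\<i> * of_real x) * z) * (- (\<i> * of_real x))) (at z within \<real>)" for z
      by (auto intro!: derivative_eq_intros)
    show "cmod (exp (- (\<i> * of_real x) * z) * (- (\<i> * of_real x))) \<le> \<bar>x\<bar>" if "z \<in> \<real>" for z
      using that by (auto simp: norm_mult elim!: Reals_cases)
  qed auto
  then show ?thesis
    by (simp add: mult_ac flip: of_real_diff)
qed

text \<open>
  The factor \<open>\<bar>s - t\<bar>\<close> makes the Lipschitz constant of the difference of two kernels tend to \<open>0\<close> as
  \<open>s\<close> tends to \<open>t\<close>. It comes out of the derivative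
  \<open>- \<i> * ((s - t) * E s + t * (E s - E t))\<close>, where \<open>E s\<close> is the kernel at frequency \<open>s\<close>.
\<close>

lemma fourier_kernel_diff_Lipschitz:
  fixes s t :: real
  defines "r \<equiv> \<lambda>x::real. exp (- (\<i> * of_real s * of_real x)) - exp (- (\<i> * of_real t * of_real x))"
  assumes x: "x \<in> {0..b}" and y: "y \<in> {0..b}"
  shows "cmod (r x - r y) \<le> \<bar>s - t\<bar> * (1 + \<bar>t\<bar> * b) * \<bar>x - y\<bar>"
proof -
  let ?E = "\<lambda>s z. exp (- (\<i> * of_real s * z))"
  let ?d = "\<lambda>z. ?E s z * (- (\<i> * of_real s)) - ?E t z * (- (\<i> * of_real t))"
  have "cmod ((?E s (of_real x) - ?E t (of_real x)) - (?E s (of_real y) - ?E t (of_real y)))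
      \<le> \<bar>s - t\<bar> * (1 + \<bar>t\<bar> * b) * cmod (of_real x - of_real y)"
  proof (rule field_differentiable_bound[where S = "of_real ` {0..b}" and f' = ?d])
    show "convex (of_real ` {0..b} :: complex set)"
      by (intro convex_linear_image linear_of_real) simp
    show "((\<lambda>z. ?E s z - ?E t z) has_field_derivative ?d z) (at z within of_real ` {0..b})" for z
      by (auto intro!: derivative_eq_intros)
    show "cmod (?d z) \<le> \<bar>s - t\<bar> * (1 + \<bar>t\<bar> * b)" if z: "z \<in> of_real ` {0..b}" for z
    proof -
      from z obtain v where v: "z = of_real v" "0 \<le> v" "v \<le> b" by auto
      have "?d z = - \<i> * (of_real (s - t) * ?E s z + of_real t * (?E s z - ?E t z))"
        by (simp add: algebra_simps)
      then have "cmod (?d z) = cmod (of_real (s - t) * ?E s z + of_real t * (?E s z - ?E t z))"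
        by (metis mult_1 norm_ii norm_minus_cancel norm_mult)
      also have "\<dots> \<le> cmod (of_real (s - t) * ?E s z) + cmod (of_real t * (?E s z - ?E t z))"
        by (rule norm_triangle_ineq)
      also have "\<dots> = \<bar>s - t\<bar> + \<bar>t\<bar> * cmod (?E s z - ?E t z)"
        by (simp add: norm_mult v flip: of_real_diff)
      also have "\<dots> \<le> \<bar>s - t\<bar> + \<bar>t\<bar> * (\<bar>s - t\<bar> * b)"
      proof (intro add_left_mono mult_left_mono)
        show "cmod (?E s z - ?E t z) \<le> \<bar>s - t\<bar> * b"
          using fourier_kernel_dist[of s v t] v
          by (smt (verit) mult_left_mono abs_ge_zero)
      qed auto
      also have "\<dots> = \<bar>s - t\<bar> * (1 + \<bar>t\<bar> * b)"
        by (simp add: algebra_simps)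
      finally show ?thesis .
    qed
  qed (use x y in auto)
  then show ?thesis
    unfolding r_def by (simp flip: of_real_diff)
qed

lemma fourier_integrand_integrable:
  assumes h: "h integrable_on {a..b}"
  shows "fourier_integrand h s integrable_on {a..b}"
proof (cases "a \<le> b")
  case True
  obtain C where "C \<ge> 0" and C: "\<And>c d. \<lbrakk>a \<le> c; c \<le> d; d \<le> b\<rbrakk> \<Longrightarrow> norm (integral {c..d} h) \<le> C"
    using integral_bounds_on_subintervals[OF h] by blast
  have "(\<lambda>x. exp (- (\<i> * of_real s * of_real x)) * of_real (h x)) integrable_on {a..b}"
  proof (rule integral_Lipschitz_weight(1)[OF h True, where L = "\<bar>s\<bar>" and C = C])
    \<comment> \<open>Position and frequency are exchanged: \<open>x\<close>, \<open>y\<close> act as frequencies at position \<open>s\<close>.\<close>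
    show "cmod (exp (- (\<i> * of_real s * of_real x)) - exp (- (\<i> * of_real s * of_real y)))
        \<le> \<bar>s\<bar> * \<bar>x - y\<bar>" for x y
      using fourier_kernel_dist[of x s y] by (simp add: mult_ac)
  qed (use C in auto)
  then show ?thesis
    by (simp add: fourier_integrand_def[abs_def])
qed (simp add: integrable_on_empty)

lemma truncated_fourier_continuous:
  assumes h: "h integrable_on {0..b}" and "b \<ge> 0"
  shows "isCont (\<lambda>s. integral {0..b} (fourier_integrand h s)) t"
proof -
  obtain C where "C \<ge> 0" and C: "\<And>c d. \<lbrakk>0 \<le> c; c \<le> d; d \<le> b\<rbrakk> \<Longrightarrow> norm (integral {c..d} h) \<le> C"
    using integral_bounds_on_subintervals[OF h] by blast
  let ?I = "\<lambda>s. integral {0..b} (fourier_integrand h s)"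
  let ?D = "2 * C * (b + 2 * (1 + \<bar>t\<bar> * b) * b)"
  have bound: "cmod (?I s - ?I t) \<le> ?D * \<bar>s - t\<bar>" for s
  proof -
    let ?r = "\<lambda>x::real. exp (- (\<i> * of_real s * of_real x)) - exp (- (\<i> * of_real t * of_real x))"
    let ?L = "\<bar>s - t\<bar> * (1 + \<bar>t\<bar> * b)"
    have "?I s - ?I t = integral {0..b} (\<lambda>x. ?r x * of_real (h x))"
      using fourier_integrand_integrable[OF h]
      by (subst integral_diff[symmetric]) (auto simp: fourier_integrand_def algebra_simps)
    also have "cmod \<dots> \<le> 2 * C * (cmod (?r 0) + cmod (?r b) + 2 * ?L * (b - 0))"
      by (rule integral_Lipschitz_weight(2)[OF h \<open>b \<ge> 0\<close>])
        (use fourier_kernel_diff_Lipschitz C \<open>b \<ge> 0\<close> in auto)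
    also have "\<dots> \<le> 2 * C * (\<bar>s - t\<bar> * b + 2 * ?L * b)"
      using fourier_kernel_dist[of s b t] \<open>b \<ge> 0\<close> \<open>C \<ge> 0\<close> by (intro mult_left_mono) auto
    also have "\<dots> = ?D * \<bar>s - t\<bar>"
      by (simp add: algebra_simps)
    finally show ?thesis .
  qed
  have "((\<lambda>s. ?I s - ?I t) \<longlongrightarrow> 0) (at t)"
  proof (rule Lim_null_comparison)
    show "\<forall>\<^sub>F s in at t. norm (?I s - ?I t) \<le> ?D * \<bar>s - t\<bar>"
      using bound by simp
    have "((\<lambda>s. ?D * \<bar>s - t\<bar>) \<longlongrightarrow> ?D * \<bar>t - t\<bar>) (at t)"
      by (intro tendsto_intros)
    then show "((\<lambda>s. ?D * \<bar>s - t\<bar>) \<longlongrightarrow> 0) (at t)"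
      by simp
  qed
  then show ?thesis
    unfolding isCont_def by (rule LIM_zero_cancel)
qed

section \<open>Improper integrals and uniform limits\<close>

text \<open>
  The half-line case of Hake's theorem. For an unbounded domain the gauge integral is
  itself defined as a limit of integrals over boxes, and a box that contains a large ball around \<open>0\<close> meets
  the half-line in an interval \<open>{0..b}\<close> with \<open>b\<close> large.
\<close>

lemma has_integral_half_lineI:
  fixes F :: "real \<Rightarrow> 'a::banach"
  assumes F: "\<And>b. b \<ge> 0 \<Longrightarrow> F integrable_on {0..b}"
    and lim: "((\<lambda>b. integral {0..b} F) \<longlongrightarrow> I) at_top"
  shows "(F has_integral I) {0..}"
proof (subst has_integral_alt', intro conjI allI impI)
  have inter: "{0..} \<inter> {a..b} = {max a 0..b}" for a b :: real
    by auto
  have sub: "F integrable_on {max a 0..b}" for a b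
    by (cases "b \<ge> 0") (auto intro: integrable_subinterval_real[OF F])
  show "(\<lambda>x. if x \<in> {0..} then F x else 0) integrable_on cbox a b" for a b
    using sub[of a b] by (simp only: integrable_restrict_Int box_real inter)
  fix e :: real assume "e > 0"
  then obtain N where N: "\<And>b. b \<ge> N \<Longrightarrow> norm (integral {0..b} F - I) < e"
    using lim unfolding tendsto_iff dist_norm eventually_at_top_linorder by blast
  show "\<exists>B>0. \<forall>a b. ball 0 B \<subseteq> cbox a b \<longrightarrow>
      norm (integral (cbox a b) (\<lambda>x. if x \<in> {0..} then F x else 0) - I) < e"
  proof (intro exI[of _ "max N 1"] conjI allI impI)
    fix a b :: real assume "ball 0 (max N 1) \<subseteq> cbox a b"
    then have sb: "{- max N 1<..<max N 1} \<subseteq> {a..b}"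
      by (simp add: ball_eq_greaterThanLessThan)
    have "- max N 1 < max N 1"
      by simp
    with sb have "a \<le> - max N 1" "max N 1 \<le> b"
      unfolding greaterThanLessThan_subseteq_atLeastAtMost_iff by blast+
    then have "a \<le> 0" "b \<ge> N"
      by simp_all
    then show "norm (integral (cbox a b) (\<lambda>x. if x \<in> {0..} then F x else 0) - I) < e"
      using N[of b] by (simp only: integral_restrict_Int box_real inter) (simp add: max_absorb2)
  qed simp
qed

lemma fourier_integrand_locally_integrable:
  assumes "hk_locally_integrable u" "0 \<le> a"
  shows "fourier_integrand u s integrable_on {a..b}"
proof (cases "a \<le> b")
  case True
  then show ?thesis
    using assms by (intro fourier_integrand_integrable) (simp add: hk_locally_integrable_def)
qed (simp add: integrable_on_empty)

text \<open>
  Uniformly small tails make the truncated transforms uniformly Cauchy near \<open>s0\<close>. Their limit is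
  the transform by Hake's theorem, and it is continuous as a uniform limit of continuous functions.
\<close>

lemma fourier_hk_continuous_at_if_uniform_tails:
  assumes u: "hk_locally_integrable u" and "\<delta> > 0"
    and tails: "\<And>e. e > 0 \<Longrightarrow> \<exists>N\<ge>0. \<forall>s b c. \<bar>s - s0\<bar> < \<delta> \<and> N \<le> b \<and> b \<le> c \<longrightarrow>
                  cmod (integral {b..c} (fourier_integrand u s)) \<le> e"
  shows "fourier_hk_continuous_at u s0"
proof -
  define I where "I b s = integral {0..b} (fourier_integrand u s)" for b s
  have step: "dist (I b s) (I c s) = cmod (integral {b..c} (fourier_integrand u s))"
    if "0 \<le> b" "b \<le> c" for b c s
  proof -
    have "I b s + integral {b..c} (fourier_integrand u s) = I c s"
      unfolding I_def using that
      by (intro Henstock_Kurzweil_Integration.integral_combine fourier_integrand_locally_integrable u) auto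
    then show ?thesis
      by (metis add_diff_cancel_left' dist_commute dist_norm)
  qed
  have Cauchy: "\<exists>N\<ge>0. \<forall>s b c. \<bar>s - s0\<bar> < \<delta> \<and> N \<le> b \<and> N \<le> c \<longrightarrow> dist (I b s) (I c s) \<le> e"
    if e: "e > 0" for e
  proof -
    obtain N where N: "N \<ge> 0"
      "\<And>s b c. \<lbrakk>\<bar>s - s0\<bar> < \<delta>; N \<le> b; b \<le> c\<rbrakk> \<Longrightarrow> cmod (integral {b..c} (fourier_integrand u s)) \<le> e"
      using tails[OF e] by blast
    have "dist (I b s) (I c s) \<le> e" if "\<bar>s - s0\<bar> < \<delta>" "N \<le> b" "N \<le> c" for s b c
      using that N step[of b c s] step[of c b s]
      by (cases "b \<le> c") (auto simp: dist_commute)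
    then show ?thesis
      using N(1) by blast
  qed
  have "\<exists>l. (\<lambda>n. I (real n) s) \<longlonglongrightarrow> l" if s: "\<bar>s - s0\<bar> < \<delta>" for s
  proof -
    have "Cauchy (\<lambda>n. I (real n) s)"
    proof (rule metric_CauchyI)
      fix e :: real assume "e > 0"
      then obtain N where N: "\<And>b c. \<lbrakk>N \<le> b; N \<le> c\<rbrakk> \<Longrightarrow> dist (I b s) (I c s) \<le> e / 2"
        using Cauchy[of "e / 2"] s by auto
      obtain n0 where "N \<le> real n0"
        using real_arch_simple by blast
      then have "dist (I (real m) s) (I (real n) s) \<le> e / 2" if "m \<ge> n0" "n \<ge> n0" for m n
        using N that by (meson of_nat_mono order_trans)
      then show "\<exists>M. \<forall>m\<ge>M. \<forall>n\<ge>M. dist (I (real m) s) (I (real n) s) < e"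
        using \<open>e > 0\<close> by (smt (verit) field_sum_of_halves)
    qed
    then show ?thesis
      by (simp add: Cauchy_convergent_iff convergent_def)
  qed
  then obtain l where l: "\<And>s. \<bar>s - s0\<bar> < \<delta> \<Longrightarrow> (\<lambda>n. I (real n) s) \<longlonglongrightarrow> l s"
    by metis
  have close: "\<exists>N\<ge>0. \<forall>s b. \<bar>s - s0\<bar> < \<delta> \<and> N \<le> b \<longrightarrow> dist (I b s) (l s) \<le> e" if "e > 0" for e
  proof -
    obtain N where N: "N \<ge> 0"
      "\<And>s b c. \<lbrakk>\<bar>s - s0\<bar> < \<delta>; N \<le> b; N \<le> c\<rbrakk> \<Longrightarrow> dist (I b s) (I c s) \<le> e"
      using Cauchy[OF \<open>e > 0\<close>] by blast
    have "dist (I b s) (l s) \<le> e" if s: "\<bar>s - s0\<bar> < \<delta>" and "N \<le> b" for s b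
    proof (rule tendsto_upperbound)
      show "(\<lambda>n. dist (I b s) (I (real n) s)) \<longlonglongrightarrow> dist (I b s) (l s)"
        by (intro tendsto_intros l s)
      have "\<forall>\<^sub>F n in sequentially. N \<le> real n"
        using filterlim_real_sequentially by (simp add: filterlim_at_top)
      then show "\<forall>\<^sub>F n in sequentially. dist (I b s) (I (real n) s) \<le> e"
        by eventually_elim (use N(2) that in blast)
    qed simp
    then show ?thesis
      using N(1) by blast
  qed
  have has: "(fourier_integrand u s has_integral l s) {0..}" if s: "\<bar>s - s0\<bar> < \<delta>" for s
  proof (rule has_integral_half_lineI)
    show "((\<lambda>b. integral {0..b} (fourier_integrand u s)) \<longlongrightarrow> l s) at_top"
    proof (rule tendstoI)
      fix e :: real assume "e > 0"
      then obtain N where "\<And>b. N \<le> b \<Longrightarrow> dist (I b s) (l s) \<le> e / 2"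
        using close[of "e / 2"] s by auto
      then have "\<And>b. N \<le> b \<Longrightarrow> dist (I b s) (l s) < e"
        using \<open>e > 0\<close> by (smt (verit) field_sum_of_halves)
      then show "\<forall>\<^sub>F b in at_top. dist (integral {0..b} (fourier_integrand u s)) (l s) < e"
        unfolding I_def eventually_at_top_linorder by blast
    qed
  qed (intro fourier_integrand_locally_integrable u order_refl)
  have hk: "fourier_hk_exists u s" "fourier_hk u s = l s" if "\<bar>s - s0\<bar> < \<delta>" for s
    using has[OF that] by (auto simp: fourier_hk_exists_def fourier_hk_def integral_unique)
  have "uniform_limit (ball s0 \<delta>) I (fourier_hk u) at_top"
  proof (rule uniform_limitI)
    fix e :: real assume "e > 0"
    then obtain N where N: "\<And>s b. \<lbrakk>\<bar>s - s0\<bar> < \<delta>; N \<le> b\<rbrakk> \<Longrightarrow> dist (I b s) (l s) \<le> e / 2"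
      using close[of "e / 2"] by auto
    have "dist (I b s) (fourier_hk u s) < e" if "s \<in> ball s0 \<delta>" "N \<le> b" for s b
    proof -
      have "\<bar>s - s0\<bar> < \<delta>"
        using that by (simp add: dist_real_def abs_minus_commute)
      then show ?thesis
        using N[of s b] that hk(2)[of s] \<open>e > 0\<close> by simp
    qed
    then show "\<forall>\<^sub>F b in at_top. \<forall>s\<in>ball s0 \<delta>. dist (I b s) (fourier_hk u s) < e"
      unfolding eventually_at_top_linorder by blast
  qed
  moreover have "\<forall>\<^sub>F b in at_top. continuous_on (ball s0 \<delta>) (I b)"
    using eventually_ge_at_top[of 0]
  proof eventually_elim
    case (elim b)
    then have "isCont (I b) s" for s
      unfolding I_def using u by (intro truncated_fourier_continuous) (auto simp: hk_locally_integrable_def)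
    then show ?case
      by (simp add: continuous_at_imp_continuous_on)
  qed
  ultimately have "continuous_on (ball s0 \<delta>) (fourier_hk u)"
    by (intro uniform_limit_theorem[where F = at_top and f = I]) auto
  then have "isCont (fourier_hk u) s0"
    using \<open>\<delta> > 0\<close> by (simp add: continuous_on_eq_continuous_at)
  moreover have "\<forall>\<^sub>F s in nhds s0. fourier_hk_exists u s"
    unfolding eventually_nhds_metric using hk(1) \<open>\<delta> > 0\<close> by (auto simp: dist_real_def)
  ultimately show ?thesis
    unfolding fourier_hk_continuous_at_def by blast
qed

lemma fourier_hk_continuous_at_lincomb:
  assumes u: "fourier_hk_continuous_at u s0" and v: "fourier_hk_continuous_at v s0"
    and f: "\<And>x. x \<ge> 0 \<Longrightarrow> f x = a * u x + b * v x"
  shows "fourier_hk_continuous_at f s0"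
proof -
  have lincomb: "fourier_hk_exists f s \<and> fourier_hk f s = of_real a * fourier_hk u s + of_real b * fourier_hk v s"
    if "fourier_hk_exists u s" "fourier_hk_exists v s" for s
  proof -
    have "((\<lambda>x. of_real a * fourier_integrand u s x) has_integral of_real a * fourier_hk u s) {0..}"
      using that(1) unfolding fourier_hk_exists_def fourier_hk_def
      by (rule has_integral_mult_right[OF integrable_integral])
    moreover have "((\<lambda>x. of_real b * fourier_integrand v s x) has_integral of_real b * fourier_hk v s) {0..}"
      using that(2) unfolding fourier_hk_exists_def fourier_hk_def
      by (rule has_integral_mult_right[OF integrable_integral])
    ultimately have "((\<lambda>x. of_real a * fourier_integrand u s x + of_real b * fourier_integrand v s x)
        has_integral (of_real a * fourier_hk u s + of_real b * fourier_hk v s)) {0..}"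
      by (rule has_integral_add)
    then have "(fourier_integrand f s has_integral
        (of_real a * fourier_hk u s + of_real b * fourier_hk v s)) {0..}"
      by (rule has_integral_eq[rotated]) (simp add: fourier_integrand_def f algebra_simps)
    then show ?thesis
      by (auto simp: fourier_hk_exists_def fourier_hk_def integral_unique)
  qed
  have "\<forall>\<^sub>F s in nhds s0. fourier_hk_exists u s \<and> fourier_hk_exists v s"
    using u v by (simp add: fourier_hk_continuous_at_def eventually_conj)
  then have ev: "\<forall>\<^sub>F s in nhds s0. fourier_hk_exists f s \<and>
      fourier_hk f s = of_real a * fourier_hk u s + of_real b * fourier_hk v s"
    by (rule eventually_mono) (use lincomb in blast)
  have "isCont (\<lambda>s. of_real a * fourier_hk u s + of_real b * fourier_hk v s) s0"
    using u v unfolding fourier_hk_continuous_at_def by (intro continuous_intros) auto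
  moreover have "isCont (fourier_hk f) s0 \<longleftrightarrow>
      isCont (\<lambda>s. of_real a * fourier_hk u s + of_real b * fourier_hk v s) s0"
    by (rule isCont_cong) (use ev in \<open>auto elim: eventually_mono\<close>)
  ultimately show ?thesis
    unfolding fourier_hk_continuous_at_def using ev by (auto elim: eventually_mono)
qed

section \<open>Monotone weights that vanish at infinity\<close>

text \<open>
  Beyond \<open>M\<close>, the integral over \<open>{b..c}\<close> is at most \<open>2 * K * (\<bar>w b\<bar> + \<bar>w c\<bar>)\<close> in modulus. This bound
  does not depend on \<open>s\<close> and tends to \<open>0\<close>, so the tails are uniformly small.
\<close>

lemma fourier_continuous_monotone_weight:
  assumes h: "hk_locally_integrable h"
    and w: "mono_on {0..} w" and w0: "(w \<longlongrightarrow> 0) at_top"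
    and "\<delta> > 0" "K > 0"
    and K: "\<And>s b c. \<lbrakk>\<bar>s - s0\<bar> < \<delta>; b > M; c > M\<rbrakk> \<Longrightarrow>
              cmod (integral {b..c} (fourier_integrand h s)) \<le> K"
  shows "fourier_hk_continuous_at (\<lambda>x. w x * h x) s0"
proof (rule fourier_hk_continuous_at_if_uniform_tails[OF _ \<open>\<delta> > 0\<close>])
  have mono: "mono_on {a..b} w" if "0 \<le> a" for a b
    by (rule mono_on_subset[OF w]) (use that in auto)
  show "hk_locally_integrable (\<lambda>x. w x * h x)"
    unfolding hk_locally_integrable_def
  proof (intro allI impI)
    fix a b :: real assume ab: "0 \<le> a" "a \<le> b"
    then have hab: "h integrable_on {a..b}"
      using h by (simp add: hk_locally_integrable_def)
    obtain C where "C \<ge> 0" "\<And>c d. \<lbrakk>a \<le> c; c \<le> d; d \<le> b\<rbrakk> \<Longrightarrow> norm (integral {c..d} h) \<le> C"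
      using integral_bounds_on_subintervals[OF hab] by blast
    then show "(\<lambda>x. w x * h x) integrable_on {a..b}"
      using ab by (intro integral_monotone_weight_real(1)[OF hab _ mono]) auto
  qed
  fix e :: real assume "e > 0"
  then have "e / (4 * K) > 0"
    using \<open>K > 0\<close> by simp
  then obtain N where N: "\<And>b. b \<ge> N \<Longrightarrow> \<bar>w b\<bar> < e / (4 * K)"
    using w0 unfolding tendsto_iff eventually_at_top_linorder by (auto simp: dist_real_def)
  show "\<exists>N\<ge>0. \<forall>s b c. \<bar>s - s0\<bar> < \<delta> \<and> N \<le> b \<and> b \<le> c \<longrightarrow>
          cmod (integral {b..c} (fourier_integrand (\<lambda>x. w x * h x) s)) \<le> e"
  \<comment> \<open>The bound \<open>K\<close> is given strictly beyond \<open>M\<close> only, hence \<open>M + 1\<close>.\<close>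
  proof (intro exI[of _ "max 0 (max N (M + 1))"] conjI allI impI; (elim conjE)?)
    fix s b c assume s: "\<bar>s - s0\<bar> < \<delta>" and b: "max 0 (max N (M + 1)) \<le> b" and "b \<le> c"
    have eq: "fourier_integrand (\<lambda>x. w x * h x) s = (\<lambda>x. of_real (w x) * fourier_integrand h s x)"
      by (auto simp: fourier_integrand_def)
    have "cmod (integral {b..c} (fourier_integrand (\<lambda>x. w x * h x) s)) \<le> 2 * K * (\<bar>w b\<bar> + \<bar>w c\<bar>)"
      unfolding eq
    proof (rule integral_monotone_weight(2))
      show "cmod (integral {a..d} (fourier_integrand h s)) \<le> K" if "b \<le> a" "a \<le> d" "d \<le> c" for a d
        using that b s by (intro K) auto
    qed (use b \<open>b \<le> c\<close> in \<open>auto intro: mono fourier_integrand_locally_integrable[OF h]\<close>)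
    also have "\<dots> \<le> 2 * K * (e / (4 * K) + e / (4 * K))"
      using N[of b] N[of c] b \<open>b \<le> c\<close> \<open>K > 0\<close> by (intro mult_left_mono add_mono) auto
    also have "\<dots> = e"
      using \<open>K > 0\<close> by (simp add: field_simps)
    finally show "cmod (integral {b..c} (fourier_integrand (\<lambda>x. w x * h x) s)) \<le> e" .
  qed simp
qed

section \<open>Jordan decomposition and limits at infinity\<close>

text \<open>
  The first component is the total variation \<open>V x\<close> of \<open>g\<close> on the part of \<open>S\<close> up to \<open>x\<close>, the second
  one is \<open>V - g\<close>. Both are increasing because \<open>V x + \<bar>g z - g x\<bar> \<le> V z\<close> for \<open>x \<le> z\<close>.
\<close>

lemma Jordan_decomposition:
  assumes g: "bounded_variation_on S g"
  obtains p q where "mono_on S p" "mono_on S q" "bdd_above (p ` S)" "bdd_above (q ` S)"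
    "g = (\<lambda>x. p x - q x)"
proof (cases "S = {}")
  case True
  show ?thesis
    by (rule that[of g "\<lambda>_. 0"]) (auto simp: True mono_on_def)
next
  case False
  then obtain x0 where x0: "x0 \<in> S" by blast
  obtain B where B: "\<forall>n y. (\<forall>i\<le>n. y i \<in> S) \<and> (\<forall>i<n. y i \<le> y (Suc i)) \<longrightarrow>
      (\<Sum>i<n. \<bar>g (y (Suc i)) - g (y i)\<bar>) \<le> B"
    using g unfolding bounded_variation_on_def ..
  define T where "T x = {\<Sum>i<n. \<bar>g (y (Suc i)) - g (y i)\<bar> | n y.
      (\<forall>i\<le>n. y i \<in> S) \<and> (\<forall>i<n. y i \<le> y (Suc i)) \<and> y n \<le> x}" for x
  define V where "V x = Sup (T x)" for x
  have TB: "v \<le> B" if "v \<in> T x" for v x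
    using that B by (auto simp: T_def)
  have bdd: "bdd_above (T x)" for x
    by (rule bdd_aboveI[OF TB])
  have T0: "0 \<in> T x" if "x \<in> S" for x
    unfolding T_def using that by (intro CollectI exI[of _ 0] exI[of _ "\<lambda>_. x"]) auto
  have VB: "V x \<le> B" if "x \<in> S" for x
    unfolding V_def using T0[OF that] TB by (intro cSup_least) auto
  have V0: "0 \<le> V x" if "x \<in> S" for x
    unfolding V_def using T0[OF that] bdd by (rule cSup_upper)
  have V_add: "V x + \<bar>g z - g x\<bar> \<le> V z" if x: "x \<in> S" and z: "z \<in> S" and "x \<le> z" for x z
  proof -
    have "v \<le> V z - \<bar>g z - g x\<bar>" if vT: "v \<in> T x" for v
    proof -
      obtain n y where y: "\<forall>i\<le>n. y i \<in> S" "\<forall>i<n. y i \<le> y (Suc i)" "y n \<le> x"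
        and v: "v = (\<Sum>i<n. \<bar>g (y (Suc i)) - g (y i)\<bar>)"
        using vT unfolding T_def by blast
      \<comment> \<open>Continue a partition that ends at or before \<open>x\<close> by the two points \<open>x\<close> and \<open>z\<close>.\<close>
      define y' where "y' i = (if i \<le> n then y i else if i = Suc n then x else z)" for i
      have "(\<Sum>i<Suc (Suc n). \<bar>g (y' (Suc i)) - g (y' i)\<bar>) \<in> T z"
        unfolding T_def
      proof (intro CollectI exI[of _ "Suc (Suc n)"] exI[of _ y'] conjI allI impI refl)
        show "y' i \<in> S" for i
          using y x z by (auto simp: y'_def)
        show "y' i \<le> y' (Suc i)" if "i < Suc (Suc n)" for i
          using y \<open>x \<le> z\<close> that by (auto simp: y'_def le_Suc_eq not_le less_Suc_eq)
        show "y' (Suc (Suc n)) \<le> z"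
          by (simp add: y'_def)
      qed
      then have "(\<Sum>i<Suc (Suc n). \<bar>g (y' (Suc i)) - g (y' i)\<bar>) \<le> V z"
        unfolding V_def using bdd by (rule cSup_upper)
      moreover have "(\<Sum>i<n. \<bar>g (y' (Suc i)) - g (y' i)\<bar>) = v"
        unfolding v by (intro sum.cong) (auto simp: y'_def)
      ultimately have "v + \<bar>g x - g (y n)\<bar> + \<bar>g z - g x\<bar> \<le> V z"
        by (simp add: y'_def)
      then show ?thesis
        by linarith
    qed
    then have "V x \<le> V z - \<bar>g z - g x\<bar>"
      unfolding V_def[of x] using T0[OF x] by (intro cSup_least) auto
    then show ?thesis
      by linarith
  qed
  show ?thesis
  proof (rule that[of V "\<lambda>x. V x - g x"])
    show "mono_on S V"
      using V_add by (intro mono_onI) (smt (verit))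
    show "mono_on S (\<lambda>x. V x - g x)"
      using V_add by (intro mono_onI) (smt (verit))
    show "bdd_above (V ` S)"
      using VB by (intro bdd_aboveI[of _ B]) auto
    have "V x - g x \<le> 2 * B - g x0" if "x \<in> S" for x
      using V_add[of x x0] V_add[of x0 x] V0 VB that x0 by (smt (verit))
    then show "bdd_above ((\<lambda>x. V x - g x) ` S)"
      by (intro bdd_aboveI[of _ "2 * B - g x0"]) auto
  qed auto
qed

lemma mono_on_half_line_convergent:
  fixes p :: "real \<Rightarrow> real"
  assumes p: "mono_on {0..} p" and bdd: "bdd_above (p ` {0..})"
  obtains L where "(p \<longlongrightarrow> L) at_top"
proof
  show "(p \<longlongrightarrow> (SUP x\<in>{0..}. p x)) at_top"
  proof (rule increasing_tendsto)
    show "\<forall>\<^sub>F x in at_top. p x \<le> (SUP x\<in>{0..}. p x)"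
      using eventually_ge_at_top[of 0]
      by eventually_elim (auto intro: cSUP_upper bdd)
    fix y assume "y < (SUP x\<in>{0..}. p x)"
    then obtain x where x: "x \<ge> 0" "y < p x"
      using less_cSUP_iff[OF _ bdd, of y] by auto
    show "\<forall>\<^sub>F z in at_top. y < p z"
    proof (rule eventually_mono[OF eventually_ge_at_top[of x]])
      fix z assume "x \<le> z"
      with x have "p x \<le> p z"
        by (intro mono_onD[OF p]) auto
      with x show "y < p z"
        by simp
    qed
  qed
qed

lemma bounded_variation_half_line_convergent:
  assumes "bounded_variation_on {0..} g"
  obtains L where "(g \<longlongrightarrow> L) at_top"
proof -
  obtain p q where p: "mono_on {0..} p" "bdd_above (p ` {0..})"
    and q: "mono_on {0..} q" "bdd_above (q ` {0..})" and gpq: "g = (\<lambda>x. p x - q x)"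
    by (rule Jordan_decomposition[OF assms])
  obtain P where "(p \<longlongrightarrow> P) at_top"
    using mono_on_half_line_convergent[OF p] .
  moreover obtain Q where "(q \<longlongrightarrow> Q) at_top"
    using mono_on_half_line_convergent[OF q] .
  ultimately have "((\<lambda>x. p x - q x) \<longlongrightarrow> P - Q) at_top"
    by (rule tendsto_diff)
  then have "(g \<longlongrightarrow> P - Q) at_top"
    by (simp only: gpq)
  then show ?thesis
    by (rule that)
qed

section \<open>Weights of bounded variation on the half-line\<close>

text \<open>
  The two components of a Jordan decomposition of \<open>g\<close> have a common limit \<open>L\<close>, as their difference
  tends to \<open>0\<close>. Subtracting \<open>L\<close> from both writes \<open>g\<close> as a difference of monotone weights that vanish
  at infinity.
\<close>

lemma fourier_continuous_vanishing_BV_weight: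
  assumes h: "hk_locally_integrable h"
    and g: "bounded_variation_on {0..} g" and g0: "(g \<longlongrightarrow> 0) at_top"
    and "\<delta> > 0" "K > 0"
    and K: "\<And>s b c. \<lbrakk>\<bar>s - s0\<bar> < \<delta>; b > M; c > M\<rbrakk> \<Longrightarrow>
              cmod (integral {b..c} (fourier_integrand h s)) \<le> K"
  shows "fourier_hk_continuous_at (\<lambda>x. g x * h x) s0"
proof -
  obtain p q where p: "mono_on {0..} p" "bdd_above (p ` {0..})"
    and q: "mono_on {0..} q" "bdd_above (q ` {0..})" and gpq: "g = (\<lambda>x. p x - q x)"
    by (rule Jordan_decomposition[OF g])
  obtain L where L: "(p \<longlongrightarrow> L) at_top"
    using mono_on_half_line_convergent[OF p] .
  have "((\<lambda>x. p x - g x) \<longlongrightarrow> L - 0) at_top"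
    by (intro tendsto_diff L g0)
  then have L': "(q \<longlongrightarrow> L) at_top"
    by (simp add: gpq)
  have "fourier_hk_continuous_at (\<lambda>x. (p x - L) * h x) s0"
  proof (rule fourier_continuous_monotone_weight[OF h _ _ \<open>\<delta> > 0\<close> \<open>K > 0\<close> K])
    show "mono_on {0..} (\<lambda>x. p x - L)"
      using p(1) by (simp add: mono_on_def)
    show "((\<lambda>x. p x - L) \<longlongrightarrow> 0) at_top"
      using L by (rule LIM_zero)
  qed
  moreover have "fourier_hk_continuous_at (\<lambda>x. (q x - L) * h x) s0"
  proof (rule fourier_continuous_monotone_weight[OF h _ _ \<open>\<delta> > 0\<close> \<open>K > 0\<close> K])
    show "mono_on {0..} (\<lambda>x. q x - L)"
      using q(1) by (simp add: mono_on_def)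
    show "((\<lambda>x. q x - L) \<longlongrightarrow> 0) at_top"
      using L' by (rule LIM_zero)
  qed
  ultimately show ?thesis
    by (rule fourier_hk_continuous_at_lincomb[where a = 1 and b = "-1"])
      (simp add: gpq algebra_simps)
qed

theorem proposition6:
  fixes g h f :: "real \<Rightarrow> real" and s0 :: real and H :: "real \<Rightarrow> real \<Rightarrow> complex"
  assumes g_BV: "bounded_variation_on {0..} g"
    and h_HKloc: "hk_locally_integrable h"
    and f_def: "f = (\<lambda>x. g x * h x)"
    and H_def: "H = (\<lambda>s x. integral {0..x} (fourier_integrand h s))"
  shows "((\<exists>M>0. \<exists>\<delta>>0. \<exists>K>0. \<forall>s M1 M2. \<bar>s - s0\<bar> < \<delta> \<and> M1 > M \<and> M2 > M \<longrightarrow>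
              cmod (integral {M1..M2} (fourier_integrand h s)) < K) \<and>
          (g \<longlongrightarrow> 0) at_top
          \<longrightarrow> fourier_hk_continuous_at f s0)
       \<and> (fourier_hk_continuous_at h s0 \<and>
          (\<exists>\<delta>>0. \<exists>K>0. \<forall>x s. x > 0 \<and> \<bar>s - s0\<bar> < \<delta> \<longrightarrow> cmod (H s x) \<le> K)
          \<longrightarrow> fourier_hk_continuous_at f s0)"
proof (intro conjI impI; elim conjE exE)
  fix M \<delta> K :: real
  assume g0: "(g \<longlongrightarrow> 0) at_top" and pos: "\<delta> > 0" "K > 0"
    and K: "\<forall>s M1 M2. \<bar>s - s0\<bar> < \<delta> \<and> M1 > M \<and> M2 > M \<longrightarrow>
              cmod (integral {M1..M2} (fourier_integrand h s)) < K"
  show "fourier_hk_continuous_at f s0"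
    unfolding f_def
    by (rule fourier_continuous_vanishing_BV_weight[OF h_HKloc g_BV g0 pos, where M = M])
      (use K in \<open>auto intro: less_imp_le\<close>)
next
  fix \<delta> K :: real
  assume h_cont: "fourier_hk_continuous_at h s0" and pos: "\<delta> > 0" "K > 0"
    and K: "\<forall>x s. x > 0 \<and> \<bar>s - s0\<bar> < \<delta> \<longrightarrow> cmod (H s x) \<le> K"
  obtain L where L: "(g \<longlongrightarrow> L) at_top"
    using bounded_variation_half_line_convergent[OF g_BV] .
  \<comment> \<open>Split \<open>f\<close> as \<open>(g - L) * h + L * h\<close>: the first part has a vanishing weight, the second
      is a multiple of \<open>h\<close>.\<close>
  have "fourier_hk_continuous_at (\<lambda>x. (g x - L) * h x) s0"
  proof (rule fourier_continuous_vanishing_BV_weight[OF h_HKloc, where \<delta> = \<delta> and K = "2 * K" and M = 0])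
    show "bounded_variation_on {0..} (\<lambda>x. g x - L)"
      using g_BV by (simp add: bounded_variation_on_def)
    show "((\<lambda>x. g x - L) \<longlongrightarrow> 0) at_top"
      using L by (rule LIM_zero)
    show "cmod (integral {b..c} (fourier_integrand h s)) \<le> 2 * K"
      if s: "\<bar>s - s0\<bar> < \<delta>" and bc: "b > 0" "c > 0" for s b c
    proof (cases "b \<le> c")
      case True
      have "H s b + integral {b..c} (fourier_integrand h s) = H s c"
        unfolding H_def using True bc
        by (intro Henstock_Kurzweil_Integration.integral_combine
            fourier_integrand_locally_integrable h_HKloc) auto
      then have "cmod (integral {b..c} (fourier_integrand h s)) = cmod (H s c - H s b)"
        by (metis add_diff_cancel_left')
      also have "\<dots> \<le> cmod (H s c) + cmod (H s b)"
        by (rule norm_triangle_ineq4)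
      also have "\<dots> \<le> 2 * K"
        using K s bc by (smt (verit))
      finally show ?thesis .
    qed (use pos in simp)
  qed (use pos in auto)
  from this h_cont show "fourier_hk_continuous_at f s0"
    unfolding f_def
    by (rule fourier_hk_continuous_at_lincomb[where a = 1 and b = L]) (simp add: algebra_simps)
qed

end
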